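(* Let $\delta>0$, $\mathbb P$ a probability measure and $\phi$ as in the context. Then for $\Lambda\in\mathcal H_I$, $$\sup_{\mathbb Q\in\mathcal P_\phi(\mathbb P,\delta)}\Lambda\mathrm{VaR}^{\mathbb Q}=\Lambda\mathrm{VaR}^{g_{\phi,\delta}\circ\mathbb P},$$ and for $\alpha\in(0,1)$, $\sup_{\mathbb Q\in\mathcal P_\phi(\mathbb P,\delta)}\mathrm{VaR}^{\mathbb Q}_\alpha=\mathrm{VaR}_\alpha^{g_{\phi,\delta}\circ\mathbb P}$ (as functionals on $\mathcal X$). Moreover, if $\phi:[0,\infty)\to\mathbb R$ is strictly convex with $\lim_{x\to\infty}\phi(x)/x=\infty$, then $$\sup_{\mathbb Q\in\mathcal P_\phi(\mathbb P,\delta)}\Lambda\mathrm{VaR}^{\mathbb Q}=(g^{-1}_{\phi,\delta}\circ\Lambda)\mathrm{VaR}^{\mathbb P},\qquad \sup_{\mathbb Q\in\mathcal P_\phi(\mathbb P,\delta)}\mathrm{VaR}^{\mathbb Q}_\alpha=\mathrm{VaR}^{\mathbb P}_{g^{-1}_{\phi,\delta}(\alpha)},$$ and for every $X\in\mathcal X$, $$\lim_{\delta\downarrow0}\sup_{\mathbb Q\in\mathcal P_\phi(\mathbb P,\delta)}\Lambda\mathrm{VaR}^{\mathbb Q}(X)=\lim_{\delta\downarrow0}(g^{-1}_{\phi,\delta}\circ\Lambda)\mathrm{VaR}^{\mathbb P}(X)=\Lambda\mathrm{VaR}^{+,\mathbb P}(X).$$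
   Context: $(\Omega,\mathcal F)$ measurable space, $\mathcal X$ a set of real-valued random variables containing the bounded ones. For a capacity $w$ (monotone set function $\mathcal F\to[0,1]$ with $w(\emptyset)=0$, $w(\Omega)=1$; probability measures and $g\circ\mathbb P$ for increasing $g:[0,1]\to[0,1]$ with $g(0)=0,g(1)=1$ are capacities) and $\Lambda:\mathbb R\to[0,1]$: $\Lambda\mathrm{VaR}^w(X)=\inf\{x: w(X>x)\le\Lambda(x)\}$, $\Lambda\mathrm{VaR}^{+,w}(X)=\sup\{x: w(X>x)\ge\Lambda(x)\}$ ($\inf\emptyset=\infty$, $\sup\emptyset=-\infty$); $\mathrm{VaR}^w_\alpha$ is $\Lambda\mathrm{VaR}^w$ with $\Lambda\equiv\alpha$. $\mathcal H_I$: increasing functions $\mathbb R\to(0,1)$. $\phi:[0,\infty)\to\mathbb R\cup\{\infty\}$ convex with $\phi(1)=0$, $\phi(0)=\lim_{x\downarrow0}\phi(x)$; $D_\phi(\mathbb Q\|\mathbb P)=\mathbb E^{\mathbb P}[\phi(\mathrm d\mathbb Q/\mathrm d\mathbb P)]$ for $\mathbb Q\ll\mathbb P$; $\mathcal P_\phi(\mathbb P,\delta)=\{\mathbb Q\ll\mathbb P:D_\phi(\mathbb Q\|\mathbb P)\le\delta\}$. $g_{\phi,\delta}(0)=0$, $g_{\phi,\delta}(1)=1$, $g_{\phi,\delta}(x)=\sup\{t\in[x,1]: x\phi(t/x)+(1-x)\phi((1-t)/(1-x))\le\delta\}$ for $x\in(0,1)$. Under the strict convexity and superlinearity assumptions,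 $g_{\phi,\delta}$ is continuous and strictly increasing from $[0,x_\delta]$ onto $[0,1]$ and equals $1$ on $[x_\delta,1]$ for some $x_\delta\in(0,1)$; $g^{-1}_{\phi,\delta}:[0,1)\to[0,x_\delta)$ denotes the inverse of this restriction, so $g^{-1}_{\phi,\delta}\circ\Lambda$ is well defined for $\Lambda$ with values in $(0,1)$. *)

theory Defs
  imports "HOL-Probability.Probability"
begin

definition LVaR :: "'a measure \<Rightarrow> (real \<Rightarrow> real) \<Rightarrow> ('a set \<Rightarrow> real) \<Rightarrow> ('a \<Rightarrow> real) \<Rightarrow> ereal" where
  "LVaR M \<Lambda> w X = Inf {ereal x | x. w {\<omega> \<in> space M. X \<omega> > x} \<le> \<Lambda> x}"

definition LVaR_plus :: "'a measure \<Rightarrow> (real \<Rightarrow> real) \<Rightarrow> ('a set \<Rightarrow> real) \<Rightarrow> ('a \<Rightarrow> real) \<Rightarrow> ereal" where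
  "LVaR_plus M \<Lambda> w X = Sup {ereal x | x. w {\<omega> \<in> space M. X \<omega> > x} \<ge> \<Lambda> x}"

definition VaR :: "'a measure \<Rightarrow> real \<Rightarrow> ('a set \<Rightarrow> real) \<Rightarrow> ('a \<Rightarrow> real) \<Rightarrow> ereal" where
  "VaR M \<alpha> w X = LVaR M (\<lambda>_. \<alpha>) w X"

definition in_H_I :: "(real \<Rightarrow> real) \<Rightarrow> bool" where
  "in_H_I \<Lambda> \<longleftrightarrow> mono \<Lambda> \<and> (\<forall>x. 0 < \<Lambda> x \<and> \<Lambda> x < 1)"

definition phi_admissible :: "(real \<Rightarrow> ereal) \<Rightarrow> bool" where
  "phi_admissible \<phi> \<longleftrightarrow>
     (\<forall>x\<ge>0. \<phi> x \<noteq> -\<infinity>) \<and>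
     (\<forall>x\<ge>0. \<forall>y\<ge>0. \<forall>t::real. 0 \<le> t \<and> t \<le> 1 \<longrightarrow>
        \<phi> (t * x + (1 - t) * y) \<le> ereal t * \<phi> x + ereal (1 - t) * \<phi> y) \<and>
     \<phi> 1 = 0 \<and>
     (\<phi> \<longlongrightarrow> \<phi> 0) (at_right 0)"

definition phi_strict_superlinear :: "(real \<Rightarrow> ereal) \<Rightarrow> bool" where
  "phi_strict_superlinear \<phi> \<longleftrightarrow>
     (\<forall>x\<ge>0. \<bar>\<phi> x\<bar> \<noteq> \<infinity>) \<and>
     (\<forall>x\<ge>0. \<forall>y\<ge>0. \<forall>t::real. x \<noteq> y \<and> 0 < t \<and> t < 1 \<longrightarrow>
        real_of_ereal (\<phi> (t * x + (1 - t) * y)) < t * real_of_ereal (\<phi> x) + (1 - t) * real_of_ereal (\<phi> y)) \<and>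
     filterlim (\<lambda>x. real_of_ereal (\<phi> x) / x) at_top at_top"

(* phi-divergence D_phi(Q||P) = E^P[phi(dQ/dP)] (positive part minus negative part) *)
definition phi_div :: "(real \<Rightarrow> ereal) \<Rightarrow> 'a measure \<Rightarrow> 'a measure \<Rightarrow> ereal" where
  "phi_div \<phi> Q P =
     enn2ereal (\<integral>\<^sup>+ \<omega>. e2ennreal (\<phi> (enn2real (RN_deriv P Q \<omega>))) \<partial>P)
     - enn2ereal (\<integral>\<^sup>+ \<omega>. e2ennreal (- \<phi> (enn2real (RN_deriv P Q \<omega>))) \<partial>P)"

definition P_phi :: "'a measure \<Rightarrow> (real \<Rightarrow> ereal) \<Rightarrow> real \<Rightarrow> 'a measure set" where
  "P_phi P \<phi> \<delta> = {Q. prob_space Q \<and> sets Q = sets P \<and> absolutely_continuous P Q \<and>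
                        phi_div \<phi> Q P \<le> ereal \<delta>}"

definition g_phi :: "(real \<Rightarrow> ereal) \<Rightarrow> real \<Rightarrow> real \<Rightarrow> real" where
  "g_phi \<phi> \<delta> x =
     (if x = 0 then 0 else if x = 1 then 1 else
      Sup {t. x \<le> t \<and> t \<le> 1 \<and>
              ereal x * \<phi> (t / x) + ereal (1 - x) * \<phi> ((1 - t) / (1 - x)) \<le> ereal \<delta>})"

(* inverse of g_phi restricted to [0, x_delta]: the unique x in [0,1] with g x = y (for y in [0,1)) *)
definition g_phi_inv :: "(real \<Rightarrow> ereal) \<Rightarrow> real \<Rightarrow> real \<Rightarrow> real" where
  "g_phi_inv \<phi> \<delta> y = (THE x. 0 \<le> x \<and> x \<le> 1 \<and> g_phi \<phi> \<delta> x = y)"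

end

theory Submission
  imports Defs
begin

text \<open>
  For an event \<open>A\<close> with \<open>0 < P A < 1\<close>, Jensen's inequality on \<open>A\<close> and on its complement shows that
  \<open>Q A = t\<close> is possible in the divergence ball only if the divergence of the Bernoulli law with
  parameter \<open>t\<close> from the one with parameter \<open>P A\<close> is at most \<open>\<delta>\<close>; a density that is constant on \<open>A\<close>
  and on its complement shows the converse. Hence \<open>g (P A)\<close> is the supremum of \<open>Q A\<close> over the ball.
  As \<open>\<Lambda>\<close> is increasing, the sets \<open>{x. Q (X > x) \<le> \<Lambda> x}\<close> are closed upwards, so the supremum of their
  infima is the infimum of their intersection.

  The Bernoulli divergence \<open>D p y\<close> is a sum of perspectives of \<open>\<phi>\<close>, hence jointly convex, and it
  vanishes on the diagonal. For \<open>p \<le> y < 1\<close> this makes \<open>g p \<le> y\<close> equivalent to \<open>\<delta> \<le> D p y\<close>, a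
  condition that is decreasing in \<open>p\<close>; superlinearity provides a \<open>p\<close> with equality, which is the
  inverse of \<open>g\<close> at \<open>y\<close>. Strict convexity makes \<open>D p y\<close> positive for \<open>p < y\<close>, so \<open>g p \<le> y\<close> once \<open>\<delta>\<close>
  is small, while \<open>g p > p\<close> for every \<open>\<delta> > 0\<close>: this gives the limit.
\<close>

subsection \<open>Convex functions\<close>

lemma convex_on_less_open_segment:
  assumes f: "convex_on S f" and xz: "x \<in> S" "z \<in> S" and y: "y \<in> open_segment x z" and less: "f x < f y"
  shows "f y < f z"
proof (rule ccontr)
  assume "\<not> f y < f z"
  obtain u where u: "0 < u" "u < 1" "y = (1 - u) *\<^sub>R x + u *\<^sub>R z"
    using y by (auto simp: in_segment)
  have "f y \<le> (1 - u) * f x + u * f z"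
    using convex_onD[OF f _ _ xz] u by simp
  also have "\<dots> < (1 - u) * f y + u * f y"
    using u less \<open>\<not> f y < f z\<close> by (intro add_less_le_mono mult_strict_left_mono mult_left_mono) auto
  finally show False by (simp add: algebra_simps)
qed

lemma convex_on_compose_affine:
  assumes f: "convex_on S f" and h: "linear h" and T: "convex T" "\<And>x. x \<in> T \<Longrightarrow> c + h x \<in> S"
  shows "convex_on T (\<lambda>x. f (c + h x))"
proof (rule convex_onI)
  fix t x y assume t: "0 < t" "t < (1::real)" and "x \<in> T" "y \<in> T"
  have "c + h ((1 - t) *\<^sub>R x + t *\<^sub>R y) = (1 - t) *\<^sub>R (c + h x) + t *\<^sub>R (c + h y)"
    by (simp only: linear_add[OF h] linear_scale[OF h]) (simp add: algebra_simps)
  then show "f (c + h ((1 - t) *\<^sub>R x + t *\<^sub>R y)) \<le> (1 - t) * f (c + h x) + t * f (c + h y)"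
    using convex_onD[OF f] t T(2) \<open>x \<in> T\<close> \<open>y \<in> T\<close> by simp
qed (rule T)

lemma convex_on_slices:
  assumes f: "convex_on (S \<times> T) (\<lambda>(x, y). f x y)"
  shows "x \<in> S \<Longrightarrow> convex_on T (f x)" and "y \<in> T \<Longrightarrow> convex_on S (\<lambda>x. f x y)"
proof -
  have "convex (S \<times> T)" by (rule convex_on_imp_convex[OF f])
  {
    assume "x \<in> S"
    have "linear (\<lambda>y. (0 :: 'a, y :: 'b))" by (auto intro!: linearI)
    moreover have "convex T"
      using convex_linear_image[OF linear_snd \<open>convex (S \<times> T)\<close>] \<open>x \<in> S\<close> by (auto split: if_splits)
    ultimately show "convex_on T (f x)"
      using convex_on_compose_affine[OF f, of "\<lambda>y. (0, y)" T "(x, 0)"] \<open>x \<in> S\<close> by simp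
  next
    assume "y \<in> T"
    have "linear (\<lambda>x. (x :: 'a, 0 :: 'b))" by (auto intro!: linearI)
    moreover have "convex S"
      using convex_linear_image[OF linear_fst \<open>convex (S \<times> T)\<close>] \<open>y \<in> T\<close> by (auto split: if_splits)
    ultimately show "convex_on S (\<lambda>x. f x y)"
      using convex_on_compose_affine[OF f, of "\<lambda>x. (x, 0)" S "(0, y)"] \<open>y \<in> T\<close> by simp
  }
qed

lemma convex_on_perspective:
  fixes f :: "real \<Rightarrow> real"
  assumes f: "convex_on {0..} f"
  shows "convex_on ({0<..} \<times> {0..}) (\<lambda>(x, t). x * f (t / x))"
proof (rule convex_onI)
  fix s :: real and v w :: "real \<times> real"
  assume s: "0 < s" "s < 1" and vw: "v \<in> {0<..} \<times> {0..}" "w \<in> {0<..} \<times> {0..}"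
  obtain x t x' t' where [simp]: "v = (x, t)" "w = (x', t')" by fastforce
  have x: "0 < x" "0 < x'" and t: "0 \<le> t" "0 \<le> t'" using vw by auto
  define X where "X = (1 - s) * x + s * x'"
  have X: "0 < X" using x s by (simp add: X_def add_pos_pos)
  \<comment> \<open>the weight of \<open>t' / x'\<close> when \<open>((1 - s) * t + s * t') / X\<close> is written as a mean of \<open>t / x\<close> and \<open>t' / x'\<close>\<close>
  define u where "u = s * x' / X"
  have X_mult_u: "X * u = s * x'" using X by (simp add: u_def)
  then have X_mult_1_minus_u: "X * (1 - u) = (1 - s) * x" by (simp only: right_diff_distrib) (simp add: X_def)
  have u: "0 \<le> u" "u \<le> 1"
    using s x X by (simp_all add: u_def X_def)
  have "X * ((1 - u) * (t / x) + u * (t' / x')) = (X * (1 - u)) * (t / x) + (X * u) * (t' / x')"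
    by (simp only: distrib_left mult.assoc)
  also have "\<dots> = (1 - s) * t + s * t'" using x unfolding X_mult_u X_mult_1_minus_u by simp
  finally have "((1 - s) * t + s * t') / X = (1 - u) * (t / x) + u * (t' / x')"
    using X by (simp add: field_simps)
  then have "X * f (((1 - s) * t + s * t') / X) \<le> X * ((1 - u) * f (t / x) + u * f (t' / x'))"
    using convex_onD[OF f u, of "t / x" "t' / x'"] x t X by simp
  also have "\<dots> = (X * (1 - u)) * f (t / x) + (X * u) * f (t' / x')"
    by (simp only: distrib_left mult.assoc)
  also have "\<dots> = (1 - s) * (x * f (t / x)) + s * (x' * f (t' / x'))"
    unfolding X_mult_u X_mult_1_minus_u by simp
  finally show "(case (1 - s) *\<^sub>R v + s *\<^sub>R w of (x, t) \<Rightarrow> x * f (t / x))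
      \<le> (1 - s) * (case v of (x, t) \<Rightarrow> x * f (t / x)) + s * (case w of (x, t) \<Rightarrow> x * f (t / x))"
    by (simp add: X_def)
qed (auto intro!: convex_Times)

lemma convex_on_real_subgradient:
  fixes f :: "real \<Rightarrow> real"
  assumes "convex_on I f" and "m \<in> interior I"
  obtains a where "\<And>z. z \<in> I \<Longrightarrow> f m + a * (z - m) \<le> f z"
  using convex_le_Inf_differential[OF assms] by blast

lemma mem_interior_convex_real:
  fixes I :: "real set"
  assumes "convex I" "l \<in> I" "u \<in> I" "l < m" "m < u"
  shows "m \<in> interior I"
proof (rule interiorI)
  show "{l<..<u} \<subseteq> I"
    using assms mem_is_interval_1_I[of I l u] by (auto simp: is_interval_convex_1)
qed (use assms in auto)

lemma convex_on_real_affine_minorant: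
  fixes f :: "real \<Rightarrow> real"
  assumes f: "convex_on I f"
  obtains a c where "\<And>z. z \<in> I \<Longrightarrow> c + a * z \<le> f z"
proof (cases "\<exists>l\<in>I. \<exists>u\<in>I. l < u")
  case True
  then obtain l u where "l \<in> I" "u \<in> I" "l < u" by blast
  then have "(l + u) / 2 \<in> interior I"
    using convex_on_imp_convex[OF f] by (intro mem_interior_convex_real[of I l u]) auto
  then obtain a where a: "\<And>z. z \<in> I \<Longrightarrow> f ((l + u) / 2) + a * (z - (l + u) / 2) \<le> f z"
    by (rule convex_on_real_subgradient[OF f]) blast
  show thesis
    by (rule that[of "f ((l + u) / 2) - a * ((l + u) / 2)" a]) (use a in \<open>auto simp: algebra_simps\<close>)
next
  case False
  then have "z = w" if "z \<in> I" "w \<in> I" for z w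
    using that by (meson linorder_less_linear)
  then show thesis
    by (intro that[where a = 0 and c = "f (SOME w. w \<in> I)"]) (metis add.right_neutral mult_zero_left order_refl someI)
qed

lemma eventually_at_right_obtains:
  fixes a b :: real
  assumes "\<forall>\<^sub>F x in at_right a. P x" and "a < b"
  obtains x where "a < x" "x < b" "P x"
proof -
  have "\<forall>\<^sub>F x in at_right a. x \<in> {a<..<b} \<and> P x"
    by (intro eventually_conj eventually_at_right_real assms)
  then show thesis
    using that eventually_happens'[of "at_right a"] by (auto simp: trivial_limit_at_right_real)
qed

lemma convex_on_less_right_neighbour:
  fixes h :: "real \<Rightarrow> real"
  assumes h: "convex_on {y..b} h" "h y < c" and "y < b"
  obtains t where "y < t" "t < b" "h t < c"
proof -
  have "((\<lambda>s. (1 - s) * h y + s * h b) \<longlongrightarrow> (1 - 0) * h y + 0 * h b) (at_right 0)"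
    by (intro tendsto_intros)
  then have "\<forall>\<^sub>F s in at_right 0. (1 - s) * h y + s * h b < c"
    by (rule order_tendstoD) (use h in simp)
  then obtain s where s: "0 < s" "s < 1" "(1 - s) * h y + s * h b < c"
    using zero_less_one by (rule eventually_at_right_obtains)
  define t where "t = (1 - s) * y + s * b"
  have "h t \<le> (1 - s) * h y + s * h b"
    using convex_onD[OF h(1), of s y b] s \<open>y < b\<close> by (simp add: t_def)
  moreover have "t - y = s * (b - y)" "b - t = (1 - s) * (b - y)"
    by (auto simp: t_def algebra_simps)
  then have "0 < t - y" "0 < b - t" using s \<open>y < b\<close> by simp_all
  ultimately show thesis using s by (intro that[of t]) auto
qed

lemma convex_on_sublevel_Sup_le_iff:
  fixes h :: "real \<Rightarrow> real"
  assumes h: "convex_on {a..b} h" "h a < c" and y: "a \<le> y" "y < b"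
  shows "Sup {t \<in> {a..b}. h t \<le> c} \<le> y \<longleftrightarrow> c \<le> h y"
proof
  assume Sup_le: "Sup {t \<in> {a..b}. h t \<le> c} \<le> y"
  show "c \<le> h y"
  proof (rule ccontr)
    assume "\<not> c \<le> h y"
    moreover have "convex_on {y..b} h" by (rule convex_on_subset[OF h(1)]) (use y in auto)
    ultimately obtain t where t: "y < t" "t < b" "h t < c"
      using convex_on_less_right_neighbour[of y b h c] y by auto
    then have "t \<le> Sup {t \<in> {a..b}. h t \<le> c}"
      using y by (intro cSup_upper bdd_aboveI[of _ b]) auto
    then show False using Sup_le t by simp
  qed
next
  assume "c \<le> h y"
  show "Sup {t \<in> {a..b}. h t \<le> c} \<le> y"
  proof (rule cSup_least)
    have "a \<in> {t \<in> {a..b}. h t \<le> c}" using h y by simp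
    then show "{t \<in> {a..b}. h t \<le> c} \<noteq> {}" by blast
    fix t assume t: "t \<in> {t \<in> {a..b}. h t \<le> c}"
    show "t \<le> y"
    proof (rule ccontr)
      assume "\<not> t \<le> y"
      moreover have "a < y" using y h \<open>c \<le> h y\<close> by (cases "a = y") auto
      ultimately have "y \<in> open_segment a t" by (auto simp: open_segment_eq_real_ivl)
      then have "h y < h t"
        by (rule convex_on_less_open_segment[OF h(1), rotated 2]) (use t h \<open>c \<le> h y\<close> y in auto)
      then show False using t \<open>c \<le> h y\<close> by simp
    qed
  qed
qed

lemma convex_on_sublevel_Sup_eq_iff:
  fixes h :: "real \<Rightarrow> real"
  assumes h: "convex_on {a..b} h" "h a < c" and y: "a < y" "y < b"
  shows "Sup {t \<in> {a..b}. h t \<le> c} = y \<longleftrightarrow> h y = c"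
proof -
  let ?S = "Sup {t \<in> {a..b}. h t \<le> c}"
  have "?S < y" if "c < h y"
  proof -
    have "convex_on {a<..<b} h" by (rule convex_on_subset[OF h(1)]) auto
    then have "isCont h y"
      using y convex_on_continuous[of "{a<..<b}" h] by (simp add: continuous_on_eq_continuous_at)
    then have "(h \<longlongrightarrow> h y) (at_left y)"
      unfolding isCont_def by (rule tendsto_within_subset) auto
    then have "\<forall>\<^sub>F t in at_left y. c < h t" using that by (rule order_tendstoD)
    moreover have "\<forall>\<^sub>F t in at_left y. t \<in> {a<..<y}" using y by (intro eventually_at_left_real)
    ultimately have "\<forall>\<^sub>F t in at_left y. c < h t \<and> t \<in> {a<..<y}" by (rule eventually_conj)
    then obtain t where t: "c < h t" "a < t" "t < y"
      using eventually_happens'[of "at_left y"] by (auto simp: trivial_limit_at_left_real)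
    have "?S \<le> t" using t y convex_on_sublevel_Sup_le_iff[OF h, of t] by simp
    then show ?thesis using t by simp
  qed
  moreover have "y \<le> ?S" if "h y \<le> c"
    using that y by (intro cSup_upper bdd_aboveI[of _ b]) auto
  moreover have "?S \<le> y \<longleftrightarrow> c \<le> h y" using y by (intro convex_on_sublevel_Sup_le_iff h) auto
  ultimately show ?thesis by linarith
qed

subsection \<open>Jensen's inequality on intervals that need not be open\<close>

context prob_space
begin

lemma AE_eq_expectation:
  fixes X :: "'a \<Rightarrow> real"
  assumes X: "integrable M X" and ge: "AE \<omega> in M. expectation X \<le> X \<omega>"
  shows "AE \<omega> in M. X \<omega> = expectation X"
proof -
  have "AE \<omega> in M. X \<omega> - expectation X = 0"
    using ge X by (subst integral_nonneg_eq_0_iff_AE[symmetric]) (auto simp: prob_space)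
  then show ?thesis by simp
qed

lemma expectation_mem_interior_or_AE_eq:
  fixes X :: "'a \<Rightarrow> real"
  assumes X: "integrable M X" "AE \<omega> in M. X \<omega> \<in> I" and I: "convex I"
  shows "expectation X \<in> interior I \<or> (AE \<omega> in M. X \<omega> = expectation X)"
proof -
  consider l u where "l \<in> I" "u \<in> I" "l < expectation X" "expectation X < u"
    | "\<And>l. l \<in> I \<Longrightarrow> expectation X \<le> l" | "\<And>u. u \<in> I \<Longrightarrow> u \<le> expectation X"
    by (meson not_le)
  then show ?thesis
  proof cases
    case 1
    then show ?thesis using mem_interior_convex_real[OF I] by blast
  next
    case 2
    then show ?thesis using X by (intro disjI2 AE_eq_expectation) (auto elim: eventually_mono)
  next
    case 3
    then have "AE \<omega> in M. - X \<omega> = expectation (\<lambda>\<omega>. - X \<omega>)"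
      using X by (intro AE_eq_expectation) (auto elim: eventually_mono)
    then show ?thesis by simp
  qed
qed

lemma jensens_inequality_convex_set:
  fixes X :: "'a \<Rightarrow> real"
  assumes X: "integrable M X" "AE \<omega> in M. X \<omega> \<in> I"
    and q: "convex_on I q" "integrable M (\<lambda>\<omega>. q (X \<omega>))"
  shows "expectation X \<in> I" and "q (expectation X) \<le> expectation (\<lambda>\<omega>. q (X \<omega>))"
proof -
  let ?m = "expectation X"
  consider "?m \<in> interior I" | "AE \<omega> in M. X \<omega> = ?m"
    using expectation_mem_interior_or_AE_eq[OF X convex_on_imp_convex[OF q(1)]] by blast
  then have "?m \<in> I \<and> q ?m \<le> expectation (\<lambda>\<omega>. q (X \<omega>))"
  proof cases
    case 1
    then obtain a where a: "\<And>z. z \<in> I \<Longrightarrow> q ?m + a * (z - ?m) \<le> q z"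
      by (rule convex_on_real_subgradient[OF q(1)]) blast
    have "q ?m = expectation (\<lambda>\<omega>. q ?m + a * (X \<omega> - ?m))"
      using X by (simp add: prob_space)
    also have "\<dots> \<le> expectation (\<lambda>\<omega>. q (X \<omega>))"
      using X q a by (intro integral_mono_AE) (auto elim: eventually_mono)
    finally show ?thesis using 1 interior_subset by blast
  next
    case 2
    have "AE \<omega> in M. ?m \<in> I" using 2 X(2) by eventually_elim simp
    moreover have "expectation (\<lambda>\<omega>. q (X \<omega>)) = expectation (\<lambda>\<omega>. q ?m)"
      using 2 q by (intro integral_cong_AE) auto
    ultimately show ?thesis by (simp add: prob_space)
  qed
  then show "?m \<in> I" and "q ?m \<le> expectation (\<lambda>\<omega>. q (X \<omega>))" by auto
qed

lemma
  fixes f :: "'a \<Rightarrow> real"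
  assumes A: "A \<in> events" "0 < prob A" and f: "integrable M f"
  shows integrable_uniform_measure: "integrable (uniform_measure M A) f"
    and integral_uniform_measure: "(\<integral>\<omega>. f \<omega> \<partial>uniform_measure M A) = (LINT \<omega>:A|M. f \<omega>) / prob A"
proof -
  have [measurable]: "f \<in> borel_measurable M" "A \<in> sets M" using A f by auto
  have "indicator A \<omega> / ennreal (prob A) = ennreal (indicator A \<omega> / prob A)" for \<omega>
    using A by (cases "\<omega> \<in> A") (simp_all add: divide_ennreal[of 1, simplified])
  then have uniform_eq_density: "uniform_measure M A = density M (\<lambda>\<omega>. ennreal (indicator A \<omega> / prob A))"
    by (simp only: uniform_measure_def emeasure_eq_measure)
  have "integrable M (\<lambda>\<omega>. indicator A \<omega> * f \<omega> / prob A)"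
    using integrable_mult_indicator[OF A(1) f] by simp
  then show "integrable (uniform_measure M A) f"
    unfolding uniform_eq_density by (subst integrable_density) simp_all
  show "(\<integral>\<omega>. f \<omega> \<partial>uniform_measure M A) = (LINT \<omega>:A|M. f \<omega>) / prob A"
    unfolding uniform_eq_density by (subst integral_density) (simp_all add: set_lebesgue_integral_def)
qed

lemma jensens_inequality_on_event:
  fixes X :: "'a \<Rightarrow> real"
  assumes A: "A \<in> events" "0 < prob A" and X: "integrable M X" "AE \<omega> in M. X \<omega> \<in> I"
    and q: "convex_on I q" "integrable M (\<lambda>\<omega>. q (X \<omega>))"
  shows "(LINT \<omega>:A|M. X \<omega>) / prob A \<in> I"
    and "prob A * q ((LINT \<omega>:A|M. X \<omega>) / prob A) \<le> (LINT \<omega>:A|M. q (X \<omega>))"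
proof -
  interpret U: prob_space "uniform_measure M A"
    using A by (intro prob_space_uniform_measure) (auto simp: emeasure_eq_measure)
  have "AE \<omega> in uniform_measure M A. X \<omega> \<in> I"
    using X A by (intro AE_uniform_measureI) auto
  note jensen = U.jensens_inequality_convex_set[OF integrable_uniform_measure[OF A X(1)] this q(1)
      integrable_uniform_measure[OF A q(2)], unfolded integral_uniform_measure[OF A X(1)]
      integral_uniform_measure[OF A q(2)]]
  from jensen(1) show "(LINT \<omega>:A|M. X \<omega>) / prob A \<in> I" .
  from jensen(2) show "prob A * q ((LINT \<omega>:A|M. X \<omega>) / prob A) \<le> (LINT \<omega>:A|M. q (X \<omega>))"
    using A(2) by (simp add: field_simps)
qed

end

subsection \<open>Divergence functions\<close>

definition edom :: "(real \<Rightarrow> ereal) \<Rightarrow> real set" where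
  "edom \<phi> = {x. 0 \<le> x \<and> \<phi> x \<noteq> \<infinity>}"

abbreviation real_phi :: "(real \<Rightarrow> ereal) \<Rightarrow> real \<Rightarrow> real" where
  "real_phi \<phi> x \<equiv> real_of_ereal (\<phi> x)"

text \<open>The \<open>\<phi>\<close>-divergence of the Bernoulli law with parameter \<open>t\<close> from the one with parameter \<open>p\<close>.\<close>

definition ebernoulli_div :: "(real \<Rightarrow> ereal) \<Rightarrow> real \<Rightarrow> real \<Rightarrow> ereal" where
  "ebernoulli_div \<phi> p t = ereal p * \<phi> (t / p) + ereal (1 - p) * \<phi> ((1 - t) / (1 - p))"

lemma phi_admissible_ereal_real:
  assumes "phi_admissible \<phi>" "x \<in> edom \<phi>"
  shows "ereal (real_phi \<phi> x) = \<phi> x"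
  using assms by (intro ereal_real') (auto simp: phi_admissible_def edom_def)

lemma phi_admissible_convexD:
  assumes "phi_admissible \<phi>" "0 \<le> x" "0 \<le> y" "0 \<le> t" "t \<le> 1"
  shows "\<phi> ((1 - t) * x + t * y) \<le> ereal (1 - t) * \<phi> x + ereal t * \<phi> y"
proof -
  have "\<forall>x\<ge>0. \<forall>y\<ge>0. \<forall>t::real. 0 \<le> t \<and> t \<le> 1 \<longrightarrow>
      \<phi> (t * x + (1 - t) * y) \<le> ereal t * \<phi> x + ereal (1 - t) * \<phi> y"
    using assms(1) by (simp add: phi_admissible_def)
  from this[rule_format, of x y "1 - t"] show ?thesis using assms by simp
qed

lemma convex_phi_sublevel:
  assumes "phi_admissible \<phi>"
  shows "convex {x. 0 \<le> x \<and> \<phi> x \<le> c}"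
  unfolding convex_alt
proof clarify
  fix x y t :: real
  assume xy: "0 \<le> x" "\<phi> x \<le> c" "0 \<le> y" "\<phi> y \<le> c" and t: "0 \<le> t" "t \<le> 1"
  have "\<phi> ((1 - t) * x + t * y) \<le> ereal (1 - t) * \<phi> x + ereal t * \<phi> y"
    using assms xy t by (intro phi_admissible_convexD)
  also have "\<dots> \<le> ereal (1 - t) * c + ereal t * c"
    using xy t by (intro add_mono ereal_mult_left_mono) auto
  also have "\<dots> = c" using t by (simp flip: ereal_left_distrib)
  finally show "0 \<le> (1 - t) *\<^sub>R x + t *\<^sub>R y \<and> \<phi> ((1 - t) *\<^sub>R x + t *\<^sub>R y) \<le> c"
    using xy t by simp
qed

lemma borel_measurable_phi:
  assumes "phi_admissible \<phi>"
  shows "\<phi> \<in> borel_measurable (restrict_space borel {0..})"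
proof (rule borel_measurableI_le)
  fix c
  have "{x. 0 \<le> x \<and> \<phi> x \<le> c} \<in> sets borel"
    using convex_phi_sublevel[OF assms] by (intro real_interval_borel_measurable) (simp add: is_interval_convex_1)
  then have "{x. 0 \<le> x \<and> \<phi> x \<le> c} \<in> sets (restrict_space borel {0..})"
    by (subst sets_restrict_space_iff) auto
  then show "{x \<in> space (restrict_space borel {0..}). \<phi> x \<le> c} \<in> sets (restrict_space borel {0..})"
    by (simp add: space_restrict_space Collect_conj_eq atLeast_def)
qed

lemma convex_on_edom:
  assumes \<phi>: "phi_admissible \<phi>"
  shows "convex_on (edom \<phi>) (real_phi \<phi>)"
proof -
  have convex_le: "\<phi> ((1 - t) * x + t * y) \<le> ereal ((1 - t) * real_phi \<phi> x + t * real_phi \<phi> y)"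
    if "x \<in> edom \<phi>" "y \<in> edom \<phi>" "0 \<le> t" "t \<le> 1" for x y t :: real
    using phi_admissible_convexD[OF \<phi>, of x y t] that
      phi_admissible_ereal_real[OF \<phi> that(1), symmetric] phi_admissible_ereal_real[OF \<phi> that(2), symmetric]
    by (metis (no_types, lifting) edom_def mem_Collect_eq plus_ereal.simps(1) times_ereal.simps(1))
  have edom_closed: "(1 - t) * x + t * y \<in> edom \<phi>" if "x \<in> edom \<phi>" "y \<in> edom \<phi>" "0 \<le> t" "t \<le> 1" for x y t :: real
    using convex_le[OF that] that by (auto simp: edom_def)
  show ?thesis
  proof (rule convex_onI)
    show "convex (edom \<phi>)" unfolding convex_alt using edom_closed by simp
    fix t x y :: real
    assume *: "0 < t" "t < 1" "x \<in> edom \<phi>" "y \<in> edom \<phi>"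
    have "ereal (real_phi \<phi> ((1 - t) * x + t * y)) \<le>
        ereal ((1 - t) * real_phi \<phi> x + t * real_phi \<phi> y)"
      using * convex_le edom_closed by (subst phi_admissible_ereal_real[OF \<phi>]) auto
    then show "real_phi \<phi> ((1 - t) *\<^sub>R x + t *\<^sub>R y)
        \<le> (1 - t) * real_phi \<phi> x + t * real_phi \<phi> y"
      by simp
  qed
qed

lemma ebernoulli_div_eq_ereal:
  assumes "phi_admissible \<phi>" "t / p \<in> edom \<phi>" "(1 - t) / (1 - p) \<in> edom \<phi>"
  shows "ebernoulli_div \<phi> p t = ereal (p * real_phi \<phi> (t / p)
    + (1 - p) * real_phi \<phi> ((1 - t) / (1 - p)))"
  unfolding ebernoulli_div_def
  using assms(2,3)[THEN phi_admissible_ereal_real[OF assms(1)], symmetric] by (metis plus_ereal.simps(1) times_ereal.simps(1))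

lemma ebernoulli_div_finite_imp_edom:
  assumes \<phi>: "phi_admissible \<phi>" and p: "0 < p" "p < 1" and t: "0 \<le> t" "t \<le> 1"
    and finite: "ebernoulli_div \<phi> p t \<noteq> \<infinity>"
  shows "t / p \<in> edom \<phi>" and "(1 - t) / (1 - p) \<in> edom \<phi>"
proof -
  have nonneg: "0 \<le> t / p" "0 \<le> (1 - t) / (1 - p)" using p t by auto
  then have "\<phi> (t / p) \<noteq> -\<infinity>" "\<phi> ((1 - t) / (1 - p)) \<noteq> -\<infinity>"
    using \<phi> by (auto simp: phi_admissible_def)
  then show "t / p \<in> edom \<phi>" "(1 - t) / (1 - p) \<in> edom \<phi>"
    using finite nonneg p by (auto simp: ebernoulli_div_def edom_def ereal_mult_eq_MInfty)
qed

lemma ebernoulli_div_same: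
  assumes "phi_admissible \<phi>" "0 < p" "p < 1"
  shows "ebernoulli_div \<phi> p p = 0"
  using assms by (simp add: ebernoulli_div_def phi_admissible_def)

lemma phi_div_eq_integral:
  assumes "AE \<omega> in P. \<phi> (enn2real (RN_deriv P Q \<omega>)) = ereal (r \<omega>)" "integrable P r"
  shows "phi_div \<phi> Q P = ereal (\<integral>\<omega>. r \<omega> \<partial>P)"
proof -
  have pos: "(\<integral>\<^sup>+ \<omega>. e2ennreal (\<phi> (enn2real (RN_deriv P Q \<omega>))) \<partial>P) = (\<integral>\<^sup>+ \<omega>. ennreal (r \<omega>) \<partial>P)"
    by (rule nn_integral_cong_AE) (use assms(1) in \<open>auto elim!: eventually_mono\<close>)
  have neg: "(\<integral>\<^sup>+ \<omega>. e2ennreal (- \<phi> (enn2real (RN_deriv P Q \<omega>))) \<partial>P) = (\<integral>\<^sup>+ \<omega>. ennreal (- r \<omega>) \<partial>P)"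
    by (rule nn_integral_cong_AE) (use assms(1) in \<open>auto elim!: eventually_mono\<close>)
  have "enn2ereal x = ereal (enn2real x)" if "x \<noteq> \<infinity>" for x
    using that by (cases x) (auto simp: enn2ereal_ennreal)
  then show ?thesis
    using assms(2) unfolding phi_div_def pos neg real_lebesgue_integral_def[OF assms(2)] real_integrable_def
    by simp
qed

locale abs_cont_prob_spaces = prob_space P + Q: prob_space Q for P Q :: "'a measure" +
  assumes sets_eq [measurable_cong]: "sets Q = sets P" and abs_cont: "absolutely_continuous P Q"
begin

lemma measure_eq_0: "A \<in> sets P \<Longrightarrow> measure P A = 0 \<Longrightarrow> measure Q A = 0"
  using absolutely_continuousD[OF abs_cont, of A] by (simp add: emeasure_eq_measure Q.emeasure_eq_measure)

lemma measure_eq_1: "A \<in> sets P \<Longrightarrow> measure P A = 1 \<Longrightarrow> measure Q A = 1"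
  using absolutely_continuous_AE[OF sets_eq abs_cont, of "\<lambda>\<omega>. \<omega> \<in> A"]
  by (simp add: prob_eq_1 Q.prob_eq_1 sets_eq)

definition dens :: "'a \<Rightarrow> real" where
  "dens \<omega> = enn2real (RN_deriv P Q \<omega>)"

lemma dens_nonneg: "0 \<le> dens \<omega>"
  by (simp add: dens_def)

lemma borel_measurable_dens [measurable]: "dens \<in> borel_measurable P"
  unfolding dens_def[abs_def] by measurable

lemma integrable_dens: "integrable P dens"
  using RN_deriv_integrable[OF Q.sigma_finite_measure_axioms abs_cont sets_eq, of "\<lambda>_. 1"]
  by (simp add: dens_def[abs_def])

lemma set_integral_dens:
  assumes "A \<in> sets P"
  shows "(LINT \<omega>:A|P. dens \<omega>) = measure Q A"
  using RN_deriv_integral[OF Q.sigma_finite_measure_axioms abs_cont sets_eq, of "indicator A"] assms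
  by (simp add: dens_def[abs_def] set_lebesgue_integral_def mult.commute sets_eq)

lemma borel_measurable_phi_dens:
  assumes "phi_admissible \<phi>"
  shows "(\<lambda>\<omega>. \<phi> (dens \<omega>)) \<in> borel_measurable P"
proof (rule measurable_compose[OF _ borel_measurable_phi[OF assms]])
  show "dens \<in> measurable P (restrict_space borel {0..})"
    by (rule measurable_restrict_space2) (auto simp: dens_nonneg)
qed

lemma
  assumes \<phi>: "phi_admissible \<phi>" and finite: "phi_div \<phi> Q P \<noteq> \<infinity>"
  shows AE_dens_in_edom: "AE \<omega> in P. dens \<omega> \<in> edom \<phi>"
    and integrable_phi_dens: "integrable P (\<lambda>\<omega>. real_phi \<phi> (dens \<omega>))" (is "integrable P ?r")
proof -
  note [measurable] = borel_measurable_phi_dens[OF \<phi>]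
  have pos: "(\<integral>\<^sup>+ \<omega>. e2ennreal (\<phi> (dens \<omega>)) \<partial>P) \<noteq> \<infinity>"
    using finite by (auto simp: phi_div_def dens_def)
  then have "AE \<omega> in P. e2ennreal (\<phi> (dens \<omega>)) \<noteq> \<infinity>"
    by (intro nn_integral_PInf_AE) auto
  then show edom: "AE \<omega> in P. dens \<omega> \<in> edom \<phi>"
    by eventually_elim (auto simp: edom_def dens_nonneg)
  obtain a c where minorant: "\<And>z. z \<in> edom \<phi> \<Longrightarrow> c + a * z \<le> real_phi \<phi> z"
    using convex_on_real_affine_minorant[OF convex_on_edom[OF \<phi>]] by metis
  have "(\<integral>\<^sup>+ \<omega>. ennreal (?r \<omega>) \<partial>P) = (\<integral>\<^sup>+ \<omega>. e2ennreal (\<phi> (dens \<omega>)) \<partial>P)"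
  proof (rule nn_integral_cong_AE)
    show "AE \<omega> in P. ennreal (?r \<omega>) = e2ennreal (\<phi> (dens \<omega>))"
      using edom by eventually_elim (simp add: phi_admissible_ereal_real[OF \<phi>] flip: e2ennreal_ereal)
  qed
  moreover have "(\<integral>\<^sup>+ \<omega>. ennreal (- ?r \<omega>) \<partial>P) \<le> (\<integral>\<^sup>+ \<omega>. ennreal (- (c + a * dens \<omega>)) \<partial>P)"
    by (rule nn_integral_mono_AE) (use edom in \<open>eventually_elim, intro ennreal_leI le_imp_neg_le minorant\<close>)
  moreover have "integrable P (\<lambda>\<omega>. c + a * dens \<omega>)" using integrable_dens by simp
  ultimately show "integrable P ?r"
    using pos by (auto simp: real_integrable_def top_unique)
qed

text \<open>The data processing inequality for the indicator of \<open>A\<close>.\<close>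

lemma ebernoulli_div_le_phi_div:
  assumes \<phi>: "phi_admissible \<phi>" and A: "A \<in> sets P" "0 < measure P A" "measure P A < 1"
  shows "ebernoulli_div \<phi> (measure P A) (measure Q A) \<le> phi_div \<phi> Q P"
proof (cases "phi_div \<phi> Q P = \<infinity>")
  case False
  note edom = AE_dens_in_edom[OF \<phi> False] and integrable = integrable_phi_dens[OF \<phi> False]
  let ?q = "real_phi \<phi>" and ?B = "space P - A"
  have jensen: "measure Q C / measure P C \<in> edom \<phi>"
    "measure P C * ?q (measure Q C / measure P C) \<le> (LINT \<omega>:C|P. ?q (dens \<omega>))"
    if "C \<in> sets P" "0 < measure P C" for C
    using jensens_inequality_on_event[OF that integrable_dens edom convex_on_edom[OF \<phi>] integrable]
    by (simp_all add: set_integral_dens that)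
  have B: "?B \<in> sets P" "measure P ?B = 1 - measure P A" "measure Q ?B = 1 - measure Q A"
    using A prob_compl Q.prob_compl[of A] sets_eq_imp_space_eq[OF sets_eq] by (auto simp: sets_eq)
  have "ebernoulli_div \<phi> (measure P A) (measure Q A) =
      ereal (measure P A * ?q (measure Q A / measure P A) + measure P ?B * ?q (measure Q ?B / measure P ?B))"
    using jensen(1)[of A] jensen(1)[of ?B] A B by (simp add: ebernoulli_div_eq_ereal[OF \<phi>])
  also have "\<dots> \<le> ereal ((LINT \<omega>:A|P. ?q (dens \<omega>)) + (LINT \<omega>:?B|P. ?q (dens \<omega>)))"
    using jensen(2)[of A] jensen(2)[of ?B] A B by (auto intro!: add_mono)
  also have "(LINT \<omega>:A|P. ?q (dens \<omega>)) + (LINT \<omega>:?B|P. ?q (dens \<omega>)) = (LINT \<omega>:A \<union> ?B|P. ?q (dens \<omega>))"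
    using A(1) B(1) integrable_mult_indicator[OF _ integrable]
    by (intro set_integral_Un[symmetric]) (auto simp: set_integrable_def)
  also have "\<dots> = (\<integral>\<omega>. ?q (dens \<omega>) \<partial>P)"
    using A(1) set_integral_space[OF integrable] by (simp add: Un_absorb1 sets.sets_into_space)
  also have "ereal \<dots> = phi_div \<phi> Q P"
    using edom integrable by (intro phi_div_eq_integral[symmetric])
      (auto simp: dens_def phi_admissible_ereal_real[OF \<phi>] elim!: eventually_mono)
  finally show ?thesis .
qed simp

end

definition two_valued_density :: "'a measure \<Rightarrow> 'a set \<Rightarrow> real \<Rightarrow> real \<Rightarrow> 'a measure" where
  "two_valued_density M A a b = density M (\<lambda>\<omega>. ennreal (if \<omega> \<in> A then a else b))"

lemma space_two_valued_density: "space (two_valued_density M A a b) = space M"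
  by (simp add: two_valued_density_def)

context prob_space
begin

lemma
  fixes a b :: real
  assumes A: "A \<in> events"
  shows integrable_two_valued: "integrable M (\<lambda>\<omega>. if \<omega> \<in> A then a else b)"
    and expectation_two_valued: "expectation (\<lambda>\<omega>. if \<omega> \<in> A then a else b) = prob A * a + (1 - prob A) * b"
proof -
  have affine_indicator: "(\<lambda>\<omega>. if \<omega> \<in> A then a else b) = (\<lambda>\<omega>. b + (a - b) * indicator A \<omega>)"
    by (auto simp: indicator_def)
  show "integrable M (\<lambda>\<omega>. if \<omega> \<in> A then a else b)" using A unfolding affine_indicator by (simp add: emeasure_eq_measure)
  show "expectation (\<lambda>\<omega>. if \<omega> \<in> A then a else b) = prob A * a + (1 - prob A) * b"
    unfolding affine_indicator using A by (simp add: prob_space emeasure_eq_measure algebra_simps)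
qed

lemma
  fixes a b :: real
  assumes A: "A \<in> events" and ab: "0 \<le> a" "0 \<le> b"
  shows emeasure_two_valued_density_space:
      "emeasure (two_valued_density M A a b) (space M) = ennreal (prob A * a + (1 - prob A) * b)"
    and emeasure_two_valued_density_event:
      "emeasure (two_valued_density M A a b) A = ennreal (prob A * a)"
proof -
  have [measurable]: "A \<in> sets M" by (rule A)
  have nn_integral: "(\<integral>\<^sup>+\<omega>. ennreal (if \<omega> \<in> A then a else c) \<partial>M) = ennreal (prob A * a + (1 - prob A) * c)"
    if "0 \<le> c" for c
    using A ab that
    by (subst nn_integral_eq_integral) (auto simp: integrable_two_valued expectation_two_valued)
  have "emeasure (two_valued_density M A a b) (space M) = (\<integral>\<^sup>+\<omega>. ennreal (if \<omega> \<in> A then a else b) \<partial>M)"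
    by (auto simp: two_valued_density_def emeasure_density intro!: nn_integral_cong)
  then show "emeasure (two_valued_density M A a b) (space M) = ennreal (prob A * a + (1 - prob A) * b)"
    using nn_integral ab by simp
  have "emeasure (two_valued_density M A a b) A = (\<integral>\<^sup>+\<omega>. ennreal (if \<omega> \<in> A then a else 0) \<partial>M)"
    by (auto simp: two_valued_density_def emeasure_density indicator_def intro!: nn_integral_cong)
  then show "emeasure (two_valued_density M A a b) A = ennreal (prob A * a)"
    using nn_integral[of 0] by simp
qed

lemma phi_div_two_valued_density:
  assumes \<phi>: "phi_admissible \<phi>" and A: "A \<in> events" and edom: "a \<in> edom \<phi>" "b \<in> edom \<phi>"
  shows "phi_div \<phi> (two_valued_density M A a b) M =
    ereal (prob A * real_phi \<phi> a + (1 - prob A) * real_phi \<phi> b)"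
proof -
  let ?Q = "two_valued_density M A a b"
  have [measurable]: "A \<in> sets M" by (rule A)
  have "AE \<omega> in M. ennreal (if \<omega> \<in> A then a else b) = RN_deriv M ?Q \<omega>"
    by (rule RN_deriv_unique) (auto simp: two_valued_density_def)
  then have "AE \<omega> in M. \<phi> (enn2real (RN_deriv M ?Q \<omega>)) =
      ereal (if \<omega> \<in> A then real_phi \<phi> a else real_phi \<phi> b)"
  proof eventually_elim
    case (elim \<omega>)
    have "0 \<le> (if \<omega> \<in> A then a else b)" using edom by (simp add: edom_def)
    then have "enn2real (RN_deriv M ?Q \<omega>) = (if \<omega> \<in> A then a else b)"
      unfolding elim[symmetric] by (rule enn2real_ennreal)
    then show ?case using edom by (simp add: phi_admissible_ereal_real[OF \<phi>])
  qed
  from phi_div_eq_integral[OF this integrable_two_valued[OF A]] show ?thesis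
    by (simp add: expectation_two_valued[OF A])
qed

lemma ebernoulli_div_attained:
  assumes \<phi>: "phi_admissible \<phi>" and A: "A \<in> events" "0 < prob A" "prob A < 1"
    and t: "0 \<le> t" "t \<le> 1" and finite: "ebernoulli_div \<phi> (prob A) t \<noteq> \<infinity>"
  obtains Q where "abs_cont_prob_spaces M Q" "measure Q A = t" "phi_div \<phi> Q M = ebernoulli_div \<phi> (prob A) t"
proof -
  define a where "a = t / prob A"
  define b where "b = (1 - t) / (1 - prob A)"
  let ?Q = "two_valued_density M A a b"
  have ab: "0 \<le> a" "0 \<le> b" "prob A * a = t" "(1 - prob A) * b = 1 - t"
    using A t by (auto simp: a_def b_def)
  have [measurable]: "A \<in> sets M" by (rule A)
  have "prob_space ?Q"
    by (rule prob_spaceI) (use A ab in \<open>simp add: space_two_valued_density emeasure_two_valued_density_space\<close>)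
  then have "abs_cont_prob_spaces M ?Q"
    by (auto simp: abs_cont_prob_spaces_def abs_cont_prob_spaces_axioms_def two_valued_density_def
        intro!: absolutely_continuousI_density prob_space_axioms)
  moreover have "measure ?Q A = t"
    using A t ab by (simp add: measure_def emeasure_two_valued_density_event)
  moreover have "phi_div \<phi> ?Q M = ebernoulli_div \<phi> (prob A) t"
    using ebernoulli_div_finite_imp_edom[OF \<phi> A(2,3) t finite] A
    by (simp add: phi_div_two_valued_density[OF \<phi>] ebernoulli_div_eq_ereal[OF \<phi>] a_def b_def)
  ultimately show thesis by (rule that)
qed

end

subsection \<open>The distortion as a supremum over the divergence ball\<close>

lemma g_phi_eq_Sup:
  "0 < p \<Longrightarrow> p < 1 \<Longrightarrow> g_phi \<phi> \<delta> p = Sup {t \<in> {p..1}. ebernoulli_div \<phi> p t \<le> ereal \<delta>}"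
  by (simp add: g_phi_def ebernoulli_div_def conj_assoc)

context prob_space
begin

lemma P_phi_iff: "Q \<in> P_phi M \<phi> \<delta> \<longleftrightarrow> abs_cont_prob_spaces M Q \<and> phi_div \<phi> Q M \<le> ereal \<delta>"
  using prob_space_axioms by (auto simp: P_phi_def abs_cont_prob_spaces_def abs_cont_prob_spaces_axioms_def)

lemma self_in_P_phi:
  assumes "phi_admissible \<phi>" "0 \<le> \<delta>"
  shows "M \<in> P_phi M \<phi> \<delta>"
proof -
  have "AE \<omega> in M. 1 = RN_deriv M M \<omega>"
    by (rule RN_deriv_unique) (auto simp: density_1)
  then have "AE \<omega> in M. \<phi> (enn2real (RN_deriv M M \<omega>)) = ereal 0"
    using assms(1) by (auto simp: phi_admissible_def zero_ereal_def elim!: eventually_mono)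
  from phi_div_eq_integral[OF this] show ?thesis
    using assms(2) prob_space_axioms by (simp add: P_phi_def absolutely_continuous_def)
qed

lemma bdd_above_P_phi: "bdd_above ((\<lambda>Q. measure Q A) ` P_phi M \<phi> \<delta>)"
  by (auto simp: P_phi_def intro!: bdd_aboveI2[where M = 1] prob_space.prob_le_1)

lemma g_phi_eq_SUP_P_phi_nontrivial:
  assumes \<phi>: "phi_admissible \<phi>" and "0 \<le> \<delta>" and A: "A \<in> events" "0 < prob A" "prob A < 1"
  shows "g_phi \<phi> \<delta> (prob A) = (SUP Q\<in>P_phi M \<phi> \<delta>. measure Q A)"
  unfolding g_phi_eq_Sup[OF A(2,3)]
proof (rule antisym)
  let ?S = "{t \<in> {prob A..1}. ebernoulli_div \<phi> (prob A) t \<le> ereal \<delta>}"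
  have self: "prob A \<in> ?S" using A ebernoulli_div_same[OF \<phi>] \<open>0 \<le> \<delta>\<close> by simp
  have bdd: "bdd_above ?S" by (rule bdd_aboveI[of _ 1]) auto
  show "Sup ?S \<le> (SUP Q\<in>P_phi M \<phi> \<delta>. measure Q A)"
  proof (rule cSup_least)
    fix t assume t: "t \<in> ?S"
    then have "0 \<le> t" "t \<le> 1" "ebernoulli_div \<phi> (prob A) t \<noteq> \<infinity>" using A by auto
    from ebernoulli_div_attained[OF \<phi> A this] obtain Q
      where "abs_cont_prob_spaces M Q" "measure Q A = t" "phi_div \<phi> Q M = ebernoulli_div \<phi> (prob A) t" .
    then show "t \<le> (SUP Q\<in>P_phi M \<phi> \<delta>. measure Q A)"
      using t by (intro cSUP_upper2[OF bdd_above_P_phi]) (auto simp: P_phi_iff)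
  qed (use self in blast)
  show "(SUP Q\<in>P_phi M \<phi> \<delta>. measure Q A) \<le> Sup ?S"
  proof (rule cSUP_least)
    fix Q assume Q: "Q \<in> P_phi M \<phi> \<delta>"
    then interpret Q: abs_cont_prob_spaces M Q by (simp add: P_phi_iff)
    have "ebernoulli_div \<phi> (prob A) (measure Q A) \<le> ereal \<delta>"
      using Q Q.ebernoulli_div_le_phi_div[OF \<phi> A] by (auto simp: P_phi_def)
    then show "measure Q A \<le> Sup ?S"
      using cSup_upper[OF _ bdd, of "measure Q A"] cSup_upper[OF self bdd] by fastforce
  qed (use self_in_P_phi[OF \<phi> \<open>0 \<le> \<delta>\<close>] in blast)
qed

lemma g_phi_eq_SUP_P_phi:
  assumes \<phi>: "phi_admissible \<phi>" and "0 \<le> \<delta>" and A: "A \<in> events"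
  shows "g_phi \<phi> \<delta> (prob A) = (SUP Q\<in>P_phi M \<phi> \<delta>. measure Q A)"
proof (cases "0 < prob A \<and> prob A < 1")
  case False
  then have trivial: "prob A = 0 \<or> prob A = 1"
    using measure_nonneg[of M A] prob_le_1[of A] by linarith
  then have "measure Q A = prob A" if "Q \<in> P_phi M \<phi> \<delta>" for Q
    using that A abs_cont_prob_spaces.measure_eq_0 abs_cont_prob_spaces.measure_eq_1
    by (auto simp: P_phi_iff)
  then have "(SUP Q\<in>P_phi M \<phi> \<delta>. measure Q A) = prob A"
    using self_in_P_phi[OF \<phi> \<open>0 \<le> \<delta>\<close>] by (metis (no_types, lifting) SUP_cong cSUP_const empty_iff)
  then show ?thesis using trivial by (auto simp: g_phi_def)
qed (use assms g_phi_eq_SUP_P_phi_nontrivial in blast)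

end

subsection \<open>Lambda value at risk under families of capacities\<close>

abbreviation upper_tail :: "'a measure \<Rightarrow> ('a \<Rightarrow> real) \<Rightarrow> real \<Rightarrow> 'a set" where
  "upper_tail M X x \<equiv> {\<omega> \<in> space M. x < X \<omega>}"

lemma antimono_capacity_upper_tail:
  fixes w :: "'a set \<Rightarrow> real"
  assumes "mono_on (sets M) w" and [measurable]: "X \<in> borel_measurable M" and "x \<le> y"
  shows "w (upper_tail M X y) \<le> w (upper_tail M X x)"
  by (rule mono_onD[OF assms(1)]) (use \<open>x \<le> y\<close> in auto)

lemma LVaR_le: "w (upper_tail M X x) \<le> \<Lambda> x \<Longrightarrow> LVaR M \<Lambda> w X \<le> ereal x"
  unfolding LVaR_def by (intro Inf_lower) auto

lemma LVaR_lessD: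
  assumes \<Lambda>: "mono \<Lambda>" and w: "mono_on (sets M) w" and X: "X \<in> borel_measurable M"
    and less: "LVaR M \<Lambda> w X < ereal x"
  shows "w (upper_tail M X x) \<le> \<Lambda> x"
proof -
  obtain z where z: "z < x" "w (upper_tail M X z) \<le> \<Lambda> z"
    using less unfolding LVaR_def Inf_less_iff by auto
  have "w (upper_tail M X x) \<le> w (upper_tail M X z)"
    using z by (intro antimono_capacity_upper_tail[OF w X]) simp
  also have "\<dots> \<le> \<Lambda> x" using z monoD[OF \<Lambda>, of z x] by simp
  finally show ?thesis .
qed

lemma SUP_LVaR_eq_LVaR_SUP:
  assumes \<Lambda>: "mono \<Lambda>" and "I \<noteq> {}" and w: "\<And>i. i \<in> I \<Longrightarrow> mono_on (sets M) (w i)"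
    and bdd: "\<And>A. A \<in> sets M \<Longrightarrow> bdd_above ((\<lambda>i. w i A) ` I)"
    and X [measurable]: "X \<in> borel_measurable M"
  shows "(SUP i\<in>I. LVaR M \<Lambda> (w i) X) = LVaR M \<Lambda> (\<lambda>A. SUP i\<in>I. w i A) X"
proof (rule antisym)
  have le_iff: "(SUP i\<in>I. w i (upper_tail M X x)) \<le> \<Lambda> x \<longleftrightarrow> (\<forall>i\<in>I. w i (upper_tail M X x) \<le> \<Lambda> x)" for x
    using \<open>I \<noteq> {}\<close> by (intro cSUP_le_iff bdd) measurable
  show "(SUP i\<in>I. LVaR M \<Lambda> (w i) X) \<le> LVaR M \<Lambda> (\<lambda>A. SUP i\<in>I. w i A) X"
    unfolding LVaR_def le_iff by (intro SUP_least Inf_superset_mono) auto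
  show "LVaR M \<Lambda> (\<lambda>A. SUP i\<in>I. w i A) X \<le> (SUP i\<in>I. LVaR M \<Lambda> (w i) X)"
  proof (rule ccontr)
    assume "\<not> LVaR M \<Lambda> (\<lambda>A. SUP i\<in>I. w i A) X \<le> (SUP i\<in>I. LVaR M \<Lambda> (w i) X)"
    then obtain v where v: "(SUP i\<in>I. LVaR M \<Lambda> (w i) X) < ereal v"
      "ereal v < LVaR M \<Lambda> (\<lambda>A. SUP i\<in>I. w i A) X"
      using ereal_dense2 by (meson not_le)
    have "w i (upper_tail M X v) \<le> \<Lambda> v" if "i \<in> I" for i
      using LVaR_lessD[OF \<Lambda> w[OF that] X] v(1) that by (meson SUP_upper le_less_trans)
    then have "LVaR M \<Lambda> (\<lambda>A. SUP i\<in>I. w i A) X \<le> ereal v"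
      by (intro LVaR_le) (simp add: le_iff)
    with v show False by simp
  qed
qed

lemma LVaR_plus_le_LVaR:
  assumes \<Lambda>: "mono \<Lambda>" and w: "mono_on (sets M) w" and X: "X \<in> borel_measurable M"
    and less: "\<And>x. \<Lambda> x \<le> w (upper_tail M X x) \<Longrightarrow> \<Lambda> x < v (upper_tail M X x)"
  shows "LVaR_plus M \<Lambda> w X \<le> LVaR M \<Lambda> v X"
  unfolding LVaR_def LVaR_plus_def
proof (intro Sup_least Inf_greatest, safe)
  fix x z assume x: "\<Lambda> x \<le> w (upper_tail M X x)" and z: "v (upper_tail M X z) \<le> \<Lambda> z"
  have "\<Lambda> z \<le> w (upper_tail M X z)" if "z \<le> x"
    using monoD[OF \<Lambda> that] x antimono_capacity_upper_tail[OF w X that] by simp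
  with less[of z] z show "ereal x \<le> ereal z" by (cases "z \<le> x") auto
qed

lemma LVaR_tendsto_LVaR_plus:
  assumes \<Lambda>: "mono \<Lambda>" and w: "mono_on (sets M) w" and X: "X \<in> borel_measurable M"
    and above: "\<forall>\<^sub>F i in F. \<forall>x. \<Lambda> x \<le> w (upper_tail M X x) \<longrightarrow> \<Lambda> x < v i (upper_tail M X x)"
    and below: "\<And>x. w (upper_tail M X x) < \<Lambda> x \<Longrightarrow> \<forall>\<^sub>F i in F. v i (upper_tail M X x) \<le> \<Lambda> x"
  shows "((\<lambda>i. LVaR M \<Lambda> (v i) X) \<longlongrightarrow> LVaR_plus M \<Lambda> w X) F"
proof (rule order_tendstoI)
  fix a assume a: "a < LVaR_plus M \<Lambda> w X"
  show "\<forall>\<^sub>F i in F. a < LVaR M \<Lambda> (v i) X"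
    using above
  proof eventually_elim
    case (elim i)
    then have "LVaR_plus M \<Lambda> w X \<le> LVaR M \<Lambda> (v i) X" by (intro LVaR_plus_le_LVaR[OF \<Lambda> w X]) auto
    with a show ?case by simp
  qed
next
  fix a assume "LVaR_plus M \<Lambda> w X < a"
  then obtain y where y: "LVaR_plus M \<Lambda> w X < ereal y" "ereal y < a" using ereal_dense2 by blast
  have "w (upper_tail M X y) < \<Lambda> y"
  proof (rule ccontr)
    assume "\<not> w (upper_tail M X y) < \<Lambda> y"
    then have "ereal y \<le> LVaR_plus M \<Lambda> w X" unfolding LVaR_plus_def by (intro Sup_upper) auto
    then show False using y by simp
  qed
  from below[OF this] show "\<forall>\<^sub>F i in F. LVaR M \<Lambda> (v i) X < a"
  proof eventually_elim
    case (elim i)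
    then have "LVaR M \<Lambda> (v i) X \<le> ereal y" by (rule LVaR_le)
    then show ?case using y by simp
  qed
qed

lemma SUP_LVaR_P_phi:
  assumes "prob_space P" and \<phi>: "phi_admissible \<phi>" and "0 \<le> \<delta>" and "mono \<Lambda>"
    and X: "X \<in> borel_measurable P"
  shows "(SUP Q\<in>P_phi P \<phi> \<delta>. LVaR P \<Lambda> (measure Q) X) = LVaR P \<Lambda> (\<lambda>A. g_phi \<phi> \<delta> (measure P A)) X"
proof -
  interpret prob_space P by fact
  have "mono_on (sets P) (measure Q)" if "Q \<in> P_phi P \<phi> \<delta>" for Q
    using that by (auto simp: P_phi_def prob_space_def intro!: mono_onI finite_measure.finite_measure_mono)
  then have "(SUP Q\<in>P_phi P \<phi> \<delta>. LVaR P \<Lambda> (measure Q) X) =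
      LVaR P \<Lambda> (\<lambda>A. SUP Q\<in>P_phi P \<phi> \<delta>. measure Q A) X"
    using self_in_P_phi[OF \<phi> \<open>0 \<le> \<delta>\<close>] bdd_above_P_phi
    by (intro SUP_LVaR_eq_LVaR_SUP \<open>mono \<Lambda>\<close> X) auto
  also have "\<dots> = LVaR P \<Lambda> (\<lambda>A. g_phi \<phi> \<delta> (measure P A)) X"
    using X by (simp add: LVaR_def g_phi_eq_SUP_P_phi[OF \<phi> \<open>0 \<le> \<delta>\<close>])
  finally show ?thesis .
qed

subsection \<open>The divergence between Bernoulli laws\<close>

definition bernoulli_div :: "(real \<Rightarrow> real) \<Rightarrow> real \<Rightarrow> real \<Rightarrow> real" where
  "bernoulli_div f p t = p * f (t / p) + (1 - p) * f ((1 - t) / (1 - p))"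

lemma bernoulli_div_same: "f 1 = 0 \<Longrightarrow> 0 < p \<Longrightarrow> p < 1 \<Longrightarrow> bernoulli_div f p p = 0"
  by (simp add: bernoulli_div_def)

lemma convex_on_bernoulli_div:
  assumes f: "convex_on {0..} f"
  shows "convex_on ({0<..<1} \<times> {0..1}) (\<lambda>(p, t). bernoulli_div f p t)"
proof -
  note perspective = convex_on_perspective[OF f]
  have convex: "convex ({0<..<1} \<times> {0..1} :: (real \<times> real) set)"
    by (intro convex_Times convex_real_interval)
  have "convex_on ({0<..<1} \<times> {0..1}) (\<lambda>(p, t). p * f (t / p))"
    by (rule convex_on_subset[OF perspective _ convex]) auto
  moreover have "convex_on ({0<..<1} \<times> {0..1}) (\<lambda>v. case (1, 1) + - v of (p, t) \<Rightarrow> p * f (t / p))"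
    by (rule convex_on_compose_affine[OF perspective _ convex]) (auto intro: linear_uminus)
  ultimately show ?thesis
    by (rule convex_on_add[elim_format]) (simp add: bernoulli_div_def case_prod_unfold)
qed

lemmas convex_on_bernoulli_div_snd = convex_on_slices(1)[OF convex_on_bernoulli_div]
  and convex_on_bernoulli_div_fst = convex_on_slices(2)[OF convex_on_bernoulli_div]

lemma bernoulli_div_pos:
  assumes strict: "\<And>x y t. 0 \<le> x \<Longrightarrow> 0 \<le> y \<Longrightarrow> x \<noteq> y \<Longrightarrow> 0 < t \<Longrightarrow> t < 1 \<Longrightarrow>
      f (t * x + (1 - t) * y) < t * f x + (1 - t) * f y"
    and "f 1 = 0" and p: "0 < p" "p < 1" and t: "0 \<le> t" "t \<le> 1" "t \<noteq> p"
  shows "0 < bernoulli_div f p t"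
proof -
  have "t / p \<noteq> (1 - t) / (1 - p)" using p t by (simp add: frac_eq_eq algebra_simps)
  then have "f (p * (t / p) + (1 - p) * ((1 - t) / (1 - p))) < bernoulli_div f p t"
    unfolding bernoulli_div_def using p t by (intro strict) auto
  moreover have "p * (t / p) + (1 - p) * ((1 - t) / (1 - p)) = 1" using p by simp
  ultimately show ?thesis using \<open>f 1 = 0\<close> by simp
qed

lemma bernoulli_div_strict_antimono:
  assumes f: "convex_on {0..} f" "f 1 = 0" and p: "0 < p" "p < q" "q < y" "y < 1"
    and pos: "0 < bernoulli_div f q y"
  shows "bernoulli_div f q y < bernoulli_div f p y"
proof (rule convex_on_less_open_segment[where f = "\<lambda>p. bernoulli_div f p y"])
  show "convex_on {0<..<1} (\<lambda>p. bernoulli_div f p y)"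
    using p by (intro convex_on_bernoulli_div_fst f) simp
  show "q \<in> open_segment y p" using p by (simp add: open_segment_eq_real_ivl)
  show "bernoulli_div f y y < bernoulli_div f q y" using pos p f by (simp add: bernoulli_div_same)
qed (use p in auto)

lemma filterlim_bernoulli_div_at_top:
  assumes f: "convex_on {0..} f" and superlinear: "filterlim (\<lambda>x. f x / x) at_top at_top" and y: "0 < y" "y < 1"
  shows "filterlim (\<lambda>p. bernoulli_div f p y) at_top (at_right 0)"
proof -
  have "filterlim (\<lambda>p. y / p) at_top (at_right 0)"
    using y by (intro LIM_at_top_divide tendsto_const eventually_at_right_less) (auto intro: tendsto_ident_at)
  from filterlim_compose[OF superlinear this]
  have "filterlim (\<lambda>p. y * (f (y / p) / (y / p))) at_top (at_right 0)"
    using y by (intro filterlim_tendsto_pos_mult_at_top[OF tendsto_const])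
  then have "filterlim (\<lambda>p. p * f (y / p)) at_top (at_right 0)" using y by (simp add: mult.commute)
  moreover have "((\<lambda>p. (1 - p) * f ((1 - y) / (1 - p))) \<longlongrightarrow> (1 - 0) * f ((1 - y) / (1 - 0))) (at_right 0)"
  proof (intro tendsto_intros isCont_tendsto_compose[where g = f])
    have "convex_on {0<..} f" by (rule convex_on_subset[OF f]) auto
    then show "isCont f ((1 - y) / (1 - 0))"
      using y convex_on_continuous[of "{0<..}" f] by (simp add: continuous_on_eq_continuous_at)
  qed auto
  ultimately show ?thesis
    unfolding bernoulli_div_def by (subst add.commute) (rule filterlim_tendsto_add_at_top)
qed

lemma bernoulli_div_attains:
  assumes f: "convex_on {0..} f" "f 1 = 0" and superlinear: "filterlim (\<lambda>x. f x / x) at_top at_top"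
    and y: "0 < y" "y < 1" and \<delta>: "0 < \<delta>"
  obtains p where "0 < p" "p < y" "bernoulli_div f p y = \<delta>"
proof -
  have "\<forall>\<^sub>F p in at_right 0. \<delta> \<le> bernoulli_div f p y"
    using filterlim_bernoulli_div_at_top[OF f(1) superlinear y] by (simp add: filterlim_at_top)
  then obtain q where q: "0 < q" "q < y" "\<delta> \<le> bernoulli_div f q y"
    using y(1) by (rule eventually_at_right_obtains)
  have "continuous_on {0<..<1} (\<lambda>p. bernoulli_div f p y)"
    using y by (intro convex_on_continuous convex_on_bernoulli_div_fst f) auto
  then have "continuous_on {q..y} (\<lambda>p. bernoulli_div f p y)"
    by (rule continuous_on_subset) (use q y in auto)
  then obtain p where p: "q \<le> p" "p \<le> y" "bernoulli_div f p y = \<delta>"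
    using IVT2'[of "\<lambda>p. bernoulli_div f p y" y \<delta> q] q \<delta> y f by (auto simp: bernoulli_div_same)
  moreover have "p \<noteq> y" using p y f \<delta> by (auto simp: bernoulli_div_same)
  ultimately show thesis using q by (intro that[of p]) auto
qed

subsection \<open>The inverse of the distortion\<close>

context
  fixes \<phi> :: "real \<Rightarrow> ereal"
  assumes admissible: "phi_admissible \<phi>" and strict: "phi_strict_superlinear \<phi>"
begin

abbreviation phi_bernoulli_div :: "real \<Rightarrow> real \<Rightarrow> real" where
  "phi_bernoulli_div \<equiv> bernoulli_div (real_phi \<phi>)"

lemma edom_eq_nonneg: "edom \<phi> = {0..}"
  using strict by (auto simp: edom_def phi_strict_superlinear_def)

lemma convex_on_real_phi: "convex_on {0..} (real_phi \<phi>)"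
  using convex_on_edom[OF admissible] by (simp add: edom_eq_nonneg)

lemma real_phi_1: "real_phi \<phi> 1 = 0"
  using admissible by (simp add: phi_admissible_def)

lemma real_phi_superlinear: "filterlim (\<lambda>x. real_phi \<phi> x / x) at_top at_top"
  using strict by (simp add: phi_strict_superlinear_def)

lemma phi_bernoulli_div_same: "0 < p \<Longrightarrow> p < 1 \<Longrightarrow> phi_bernoulli_div p p = 0"
  by (simp add: bernoulli_div_same real_phi_1)

lemma phi_bernoulli_div_pos: "0 < p \<Longrightarrow> p < t \<Longrightarrow> t \<le> 1 \<Longrightarrow> 0 < phi_bernoulli_div p t"
  using strict unfolding phi_strict_superlinear_def by (intro bernoulli_div_pos real_phi_1) auto

lemma g_phi_eq_Sup_bernoulli_div:
  assumes "0 < p" "p < 1"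
  shows "g_phi \<phi> \<delta> p = Sup {t \<in> {p..1}. phi_bernoulli_div p t \<le> \<delta>}"
proof -
  have "ebernoulli_div \<phi> p t = ereal (phi_bernoulli_div p t)" if "t \<in> {p..1}" for t
    using that assms by (simp add: ebernoulli_div_eq_ereal[OF admissible] edom_eq_nonneg bernoulli_div_def)
  then show ?thesis using assms by (auto simp: g_phi_eq_Sup intro!: arg_cong[of _ _ Sup])
qed

lemma
  assumes p: "0 < p" "p < 1" and \<delta>: "0 < \<delta>"
  shows g_phi_le_iff: "p \<le> y \<Longrightarrow> y < 1 \<Longrightarrow> g_phi \<phi> \<delta> p \<le> y \<longleftrightarrow> \<delta> \<le> phi_bernoulli_div p y"
    and g_phi_eq_iff: "p < y \<Longrightarrow> y < 1 \<Longrightarrow> g_phi \<phi> \<delta> p = y \<longleftrightarrow> phi_bernoulli_div p y = \<delta>"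
proof -
  have convex_less: "convex_on {p..1} (phi_bernoulli_div p)" "phi_bernoulli_div p p < \<delta>"
    using p \<delta> convex_on_subset[OF convex_on_bernoulli_div_snd[OF convex_on_real_phi], of p "{p..1}"]
    by (auto simp: phi_bernoulli_div_same)
  show "p \<le> y \<Longrightarrow> y < 1 \<Longrightarrow> g_phi \<phi> \<delta> p \<le> y \<longleftrightarrow> \<delta> \<le> phi_bernoulli_div p y"
    unfolding g_phi_eq_Sup_bernoulli_div[OF p] by (rule convex_on_sublevel_Sup_le_iff[OF convex_less])
  show "p < y \<Longrightarrow> y < 1 \<Longrightarrow> g_phi \<phi> \<delta> p = y \<longleftrightarrow> phi_bernoulli_div p y = \<delta>"
    unfolding g_phi_eq_Sup_bernoulli_div[OF p] by (rule convex_on_sublevel_Sup_eq_iff[OF convex_less])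
qed

lemma less_g_phi:
  assumes "0 < p" "p < 1" "0 < \<delta>"
  shows "p < g_phi \<phi> \<delta> p"
  using g_phi_le_iff[of p \<delta> p] assms by (simp add: phi_bernoulli_div_same)

lemma phi_bernoulli_div_less_iff:
  assumes "0 < p" "0 < q" "p < y" "q < y" "y < 1"
  shows "phi_bernoulli_div p y < phi_bernoulli_div q y \<longleftrightarrow> q < p"
proof -
  have "phi_bernoulli_div b y < phi_bernoulli_div a y" if "0 < a" "a < b" "b < y" for a b
    using that assms by (intro bernoulli_div_strict_antimono convex_on_real_phi real_phi_1 phi_bernoulli_div_pos) auto
  from this[of q p] this[of p q] show ?thesis using assms by (cases p q rule: linorder_cases) auto
qed

lemma
  assumes y: "0 < y" "y < 1" and \<delta>: "0 < \<delta>"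
  shows g_phi_inv_pos: "0 < g_phi_inv \<phi> \<delta> y" and g_phi_inv_less: "g_phi_inv \<phi> \<delta> y < y"
    and phi_bernoulli_div_g_phi_inv: "phi_bernoulli_div (g_phi_inv \<phi> \<delta> y) y = \<delta>"
proof -
  obtain p where p: "0 < p" "p < y" "phi_bernoulli_div p y = \<delta>"
    by (rule bernoulli_div_attains[OF convex_on_real_phi real_phi_1 real_phi_superlinear y \<delta>])
  have "g_phi_inv \<phi> \<delta> y = p"
    unfolding g_phi_inv_def
  proof (rule the_equality)
    show "0 \<le> p \<and> p \<le> 1 \<and> g_phi \<phi> \<delta> p = y" using p y \<delta> by (simp add: g_phi_eq_iff)
    fix q assume q: "0 \<le> q \<and> q \<le> 1 \<and> g_phi \<phi> \<delta> q = y"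
    then have "q \<noteq> 0" "q \<noteq> 1" using y by (auto simp: g_phi_def)
    then have "0 < q" "q < y" using q \<delta> less_g_phi[of q \<delta>] by auto
    with p q y \<delta> show "q = p"
      using phi_bernoulli_div_less_iff[of p q y] phi_bernoulli_div_less_iff[of q p y] by (simp add: g_phi_eq_iff)
  qed
  then show "0 < g_phi_inv \<phi> \<delta> y" "g_phi_inv \<phi> \<delta> y < y" "phi_bernoulli_div (g_phi_inv \<phi> \<delta> y) y = \<delta>"
    using p by simp_all
qed

lemma g_phi_le_iff_le_g_phi_inv:
  assumes y: "0 < y" "y < 1" and \<delta>: "0 < \<delta>" and p: "0 \<le> p" "p \<le> 1"
  shows "g_phi \<phi> \<delta> p \<le> y \<longleftrightarrow> p \<le> g_phi_inv \<phi> \<delta> y"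
proof -
  note inv = g_phi_inv_pos[OF y \<delta>] g_phi_inv_less[OF y \<delta>] phi_bernoulli_div_g_phi_inv[OF y \<delta>]
  consider "p = 0" | "p = 1" | "0 < p" "p < y" | "0 < p" "p < 1" "y \<le> p" using y p by linarith
  then show ?thesis
  proof cases
    case 3
    then have "g_phi \<phi> \<delta> p \<le> y \<longleftrightarrow> phi_bernoulli_div (g_phi_inv \<phi> \<delta> y) y \<le> phi_bernoulli_div p y"
      using y \<delta> by (simp add: g_phi_le_iff inv)
    also have "\<dots> \<longleftrightarrow> p \<le> g_phi_inv \<phi> \<delta> y"
      using phi_bernoulli_div_less_iff[of p "g_phi_inv \<phi> \<delta> y" y] 3 y inv by linarith
    finally show ?thesis .
  next
    case 4
    then show ?thesis using less_g_phi[of p \<delta>] \<delta> inv by simp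
  qed (use y inv in \<open>auto simp: g_phi_def\<close>)
qed

lemma eventually_g_phi_le:
  assumes "0 \<le> p" "p < y" "y < 1"
  shows "\<forall>\<^sub>F \<delta> in at_right 0. g_phi \<phi> \<delta> p \<le> y"
proof (cases "p = 0")
  case False
  with assms have "\<forall>\<^sub>F \<delta> in at_right 0. \<delta> \<in> {0<..<phi_bernoulli_div p y}"
    by (intro eventually_at_right_real phi_bernoulli_div_pos) auto
  then show ?thesis by eventually_elim (use False assms in \<open>simp add: g_phi_le_iff\<close>)
qed (use assms in \<open>simp add: g_phi_def\<close>)

lemma LVaR_g_phi_eq_LVaR_g_phi_inv:
  assumes "prob_space P" and \<delta>: "0 < \<delta>" and \<Lambda>: "in_H_I \<Lambda>"
  shows "LVaR P \<Lambda> (\<lambda>A. g_phi \<phi> \<delta> (measure P A)) X = LVaR P (g_phi_inv \<phi> \<delta> \<circ> \<Lambda>) (measure P) X"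
  using \<delta> \<Lambda> prob_space.prob_le_1[OF \<open>prob_space P\<close>]
  by (simp add: LVaR_def in_H_I_def g_phi_le_iff_le_g_phi_inv)

lemma LVaR_g_phi_tendsto_LVaR_plus:
  assumes P: "prob_space P" and \<Lambda>: "in_H_I \<Lambda>" and X: "X \<in> borel_measurable P"
  shows "((\<lambda>\<delta>. LVaR P \<Lambda> (\<lambda>A. g_phi \<phi> \<delta> (measure P A)) X) \<longlongrightarrow> LVaR_plus P \<Lambda> (measure P) X) (at_right 0)"
proof (rule LVaR_tendsto_LVaR_plus)
  interpret prob_space P by (rule P)
  show "mono \<Lambda>" using \<Lambda> by (simp add: in_H_I_def)
  show "mono_on (sets P) (measure P)" by (auto intro!: mono_onI finite_measure_mono)
  have "\<Lambda> x < g_phi \<phi> \<delta> p" if "0 < \<delta>" "\<Lambda> x \<le> p" "p \<le> 1" for \<delta> x p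
  proof (cases "p = 1")
    case False
    then have "p < g_phi \<phi> \<delta> p"
      using that \<Lambda> by (intro less_g_phi) (auto simp: in_H_I_def intro: less_le_trans)
    then show ?thesis using that by simp
  qed (use \<Lambda> in \<open>simp add: g_phi_def in_H_I_def\<close>)
  then show "\<forall>\<^sub>F \<delta> in at_right 0. \<forall>x. \<Lambda> x \<le> measure P (upper_tail P X x) \<longrightarrow>
      \<Lambda> x < g_phi \<phi> \<delta> (measure P (upper_tail P X x))"
    using eventually_at_right_less[of 0] by (auto elim!: eventually_mono)
  show "\<forall>\<^sub>F \<delta> in at_right 0. g_phi \<phi> \<delta> (measure P (upper_tail P X x)) \<le> \<Lambda> x"
    if "measure P (upper_tail P X x) < \<Lambda> x" for x
    using that \<Lambda> by (intro eventually_g_phi_le) (auto simp: in_H_I_def)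
qed (rule X)

end

theorem mainTheorem6:
  fixes P :: "'a measure" and \<phi> :: "real \<Rightarrow> ereal"
  assumes "prob_space P" and "phi_admissible \<phi>"
  shows "(\<forall>\<delta>>0. \<forall>\<Lambda>. in_H_I \<Lambda> \<longrightarrow> (\<forall>X \<in> borel_measurable P.
            (SUP Q\<in>P_phi P \<phi> \<delta>. LVaR P \<Lambda> (measure Q) X)
              = LVaR P \<Lambda> (\<lambda>A. g_phi \<phi> \<delta> (measure P A)) X))
       \<and> (\<forall>\<delta>>0. \<forall>\<alpha>\<in>{0<..<1}. \<forall>X \<in> borel_measurable P.
            (SUP Q\<in>P_phi P \<phi> \<delta>. VaR P \<alpha> (measure Q) X)
              = VaR P \<alpha> (\<lambda>A. g_phi \<phi> \<delta> (measure P A)) X)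
       \<and> (phi_strict_superlinear \<phi> \<longrightarrow>
            (\<forall>\<delta>>0. \<forall>\<Lambda>. in_H_I \<Lambda> \<longrightarrow> (\<forall>X \<in> borel_measurable P.
               (SUP Q\<in>P_phi P \<phi> \<delta>. LVaR P \<Lambda> (measure Q) X)
                 = LVaR P (g_phi_inv \<phi> \<delta> \<circ> \<Lambda>) (measure P) X))
          \<and> (\<forall>\<delta>>0. \<forall>\<alpha>\<in>{0<..<1}. \<forall>X \<in> borel_measurable P.
               (SUP Q\<in>P_phi P \<phi> \<delta>. VaR P \<alpha> (measure Q) X)
                 = VaR P (g_phi_inv \<phi> \<delta> \<alpha>) (measure P) X)
          \<and> (\<forall>\<Lambda>. in_H_I \<Lambda> \<longrightarrow> (\<forall>X \<in> borel_measurable P.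
               ((\<lambda>\<delta>. SUP Q\<in>P_phi P \<phi> \<delta>. LVaR P \<Lambda> (measure Q) X)
                  \<longlongrightarrow> LVaR_plus P \<Lambda> (measure P) X) (at_right 0)
             \<and> ((\<lambda>\<delta>. LVaR P (g_phi_inv \<phi> \<delta> \<circ> \<Lambda>) (measure P) X)
                  \<longlongrightarrow> LVaR_plus P \<Lambda> (measure P) X) (at_right 0))))"
proof -
  have const_in_H_I: "in_H_I (\<lambda>_. \<alpha>)" if "\<alpha> \<in> {0<..<1}" for \<alpha> :: real
    using that by (simp add: in_H_I_def)
  have SUP_eq: "(SUP Q\<in>P_phi P \<phi> \<delta>. LVaR P \<Lambda> (measure Q) X) = LVaR P \<Lambda> (\<lambda>A. g_phi \<phi> \<delta> (measure P A)) X"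
    if "0 < \<delta>" "in_H_I \<Lambda>" "X \<in> borel_measurable P" for \<delta> \<Lambda> X
    using that by (intro SUP_LVaR_P_phi assms) (auto simp: in_H_I_def)
  have inverse_eq: "LVaR P \<Lambda> (\<lambda>A. g_phi \<phi> \<delta> (measure P A)) X = LVaR P (g_phi_inv \<phi> \<delta> \<circ> \<Lambda>) (measure P) X"
    if "phi_strict_superlinear \<phi>" "0 < \<delta>" "in_H_I \<Lambda>" for \<delta> \<Lambda> X
    using assms that by (intro LVaR_g_phi_eq_LVaR_g_phi_inv)
  have limit: "((\<lambda>\<delta>. LVaR P \<Lambda> (\<lambda>A. g_phi \<phi> \<delta> (measure P A)) X) \<longlongrightarrow> LVaR_plus P \<Lambda> (measure P) X) (at_right 0)"
    if "phi_strict_superlinear \<phi>" "in_H_I \<Lambda>" "X \<in> borel_measurable P" for \<Lambda> X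
    using assms that by (intro LVaR_g_phi_tendsto_LVaR_plus)
  have limit_eq: "(h \<longlongrightarrow> LVaR_plus P \<Lambda> (measure P) X) (at_right 0)"
    if "phi_strict_superlinear \<phi>" "in_H_I \<Lambda>" "X \<in> borel_measurable P"
      and "\<And>\<delta>. 0 < \<delta> \<Longrightarrow> LVaR P \<Lambda> (\<lambda>A. g_phi \<phi> \<delta> (measure P A)) X = h \<delta>" for \<Lambda> X h
    by (rule Lim_transform_eventually[OF limit[OF that(1-3)] eventually_mono[OF eventually_at_right_less that(4)]])
  show ?thesis
    by (intro conjI allI impI ballI limit_eq)
      (simp_all add: VaR_def SUP_eq const_in_H_I inverse_eq[unfolded comp_def] comp_def)
qed

end
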